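(* Run the ALPD method with positive parameters $\beta_t,\gamma_t,\tau_t,\eta_t$ ($t\ge1$) and $\theta_t$, and suppose that $$\beta_1=1,\qquad \beta_{t+1}-1=\beta_t\theta_{t+1}\ (t\ge1),\qquad \theta_t=\frac{\gamma_{t-1}}{\gamma_t},\quad 0\le\theta_t\le\frac{\tau_{t-1}}{\tau_t}\ (t\ge2),$$ $$\frac1{2\eta_t}-\frac{L_f}{2\beta_t}-2L_{xy}^2\tau_t\ge\frac{L_{xx}}2,\qquad \frac1{4\tau_t}-\frac{L_g}2-2L_{yy}^2\tau_t\ge0\quad(t\ge1),$$ and, in addition, for all $t\ge2$, $$\gamma_t\Big(\frac1{\tau_t}-\mu_g\Big)\le\frac{\gamma_{t-1}}{\tau_{t-1}},\qquad \frac{\gamma_t}{\eta_t}\le\frac{\gamma_{t-1}}{\eta_{t-1}}+\frac{L_{xx}}2 .$$ Then for every $K\ge1$ the output $\bar z_{K+1}=(\bar x_{K+1},\bar y_{K+1})$ satisfies $$\mathrm{Gap}(\bar z_{K+1})\le\Big(\frac{\gamma_1}{\beta_K\gamma_K\eta_1}+\frac{KL_{xx}}{\beta_K\gamma_K}\Big)D_X^2+\frac{\gamma_1}{\beta_K\gamma_K\tau_1}D_Y^2 .$$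
   Context: Problem: $\min_{x\in X}\max_{y\in Y}\mathcal L(x,y)$, $\mathcal L(x,y)=f(x)+\phi(x,y)-g(y)$, where $X\subseteq\mathbb R^n$, $Y\subseteq\mathbb R^m$ are nonempty compact convex sets; $f:X\to\mathbb R$ is convex with $L_f$-Lipschitz gradient; $g:Y\to\mathbb R$ is differentiable with $L_g$-Lipschitz gradient and strongly convex with modulus $\mu_g>0$, i.e. $g(y')-g(y)-\langle\nabla g(y),y'-y\rangle\ge\frac{\mu_g}2\|y'-y\|^2$; $\phi:X\times Y\to\mathbb R$ is differentiable, convex in $x$ for every $y$, concave in $y$ for every $x$, and for all $x,x'\in X$, $y,y'\in Y$: $\|\nabla_x\phi(x',y)-\nabla_x\phi(x,y)\|\le L_{xx}\|x'-x\|$, $\|\nabla_y\phi(x,y')-\nabla_y\phi(x,y)\|\le L_{yy}\|y'-y\|$, $\|\nabla_y\phi(x',y)-\nabla_y\phi(x,y)\|\le L_{xy}\|x'-x\|$. $\|\cdot\|$ is the Euclidean norm. For compact $W$, $D_W=\max_{w,w'\in W}\|w'-w\|/\sqrt2$. For $\bar z=(\bar x,\bar y)$, $z=(x,y)$ in $X\times Y$: $Q(\bar z,z)=\mathcal L(\bar x,y)-\mathcal L(x,\bar y)$ and $\mathrm{Gap}(\bar z)=\max_{z\in X\times Y}Q(\bar z,z)$. ALPD method: start with $\bar x_1=x_0=x_1\in X$, $\bar y_1=y_0=y_1\in Y$. For $t=1,\dots,K$: $\underline x_t=(1-\beta_t^{-1})\bar x_t+\beta_t^{-1}x_t$; $v_t=(1+\theta_t)\nabla_y\phi(x_t,y_t)-\theta_t\nabla_y\phi(x_{t-1},y_{t-1})$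 (the value of $\theta_1$ is irrelevant); $y_{t+1}=\arg\min_{y\in Y}\langle -v_t+\nabla g(y_t),y\rangle+\frac1{2\tau_t}\|y-y_t\|^2$; $x_{t+1}=\arg\min_{x\in X}\langle\nabla f(\underline x_t)+\nabla_x\phi(x_t,y_{t+1}),x\rangle+\frac1{2\eta_t}\|x-x_t\|^2$; $\bar x_{t+1}=(1-\beta_t^{-1})\bar x_t+\beta_t^{-1}x_{t+1}$, $\bar y_{t+1}=(1-\beta_t^{-1})\bar y_t+\beta_t^{-1}y_{t+1}$. Output $\bar z_{K+1}=(\bar x_{K+1},\bar y_{K+1})$. *)

theory Defs
  imports "HOL-Analysis.Analysis"
begin

text \<open>
  Gradients are relative to the domain (derivative within \<^term>\<open>S\<close>), so the objective need not be
  differentiable, or even meaningful, outside of the constraint set.  If \<^term>\<open>S\<close> has empty interior the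
  gradient is not unique; \<^term>\<open>G\<close> is then an arbitrary but fixed choice of gradients.
\<close>

definition gradient_on :: "('a::real_inner \<Rightarrow> real) \<Rightarrow> ('a \<Rightarrow> 'a) \<Rightarrow> 'a set \<Rightarrow> bool" where
  "gradient_on F G S \<longleftrightarrow> (\<forall>u\<in>S. (F has_derivative (\<lambda>h. G u \<bullet> h)) (at u within S))"

definition strongly_convex_on ::
    "real \<Rightarrow> ('a::real_inner \<Rightarrow> real) \<Rightarrow> ('a \<Rightarrow> 'a) \<Rightarrow> 'a set \<Rightarrow> bool" where
  "strongly_convex_on \<mu> F G S \<longleftrightarrow>
     (\<forall>u\<in>S. \<forall>u'\<in>S. F u' - F u - G u \<bullet> (u' - u) \<ge> \<mu> / 2 * (norm (u' - u))\<^sup>2)"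

definition lagr ::
    "('a \<Rightarrow> real) \<Rightarrow> ('a \<Rightarrow> 'b \<Rightarrow> real) \<Rightarrow> ('b \<Rightarrow> real) \<Rightarrow> 'a \<Rightarrow> 'b \<Rightarrow> real" where
  "lagr f \<phi> g x y = f x + \<phi> x y - g y"

definition gapQ ::
    "('a \<Rightarrow> real) \<Rightarrow> ('a \<Rightarrow> 'b \<Rightarrow> real) \<Rightarrow> ('b \<Rightarrow> real) \<Rightarrow> 'a \<times> 'b \<Rightarrow> 'a \<times> 'b \<Rightarrow> real" where
  "gapQ f \<phi> g zb z = lagr f \<phi> g (fst zb) (snd z) - lagr f \<phi> g (fst z) (snd zb)"

text \<open>The maximum is written as a supremum; \<open>Gap_attained\<close> below shows that it is attained.\<close>

definition Gap ::
    "('a \<Rightarrow> real) \<Rightarrow> ('a \<Rightarrow> 'b \<Rightarrow> real) \<Rightarrow> ('b \<Rightarrow> real) \<Rightarrow> 'a set \<Rightarrow> 'b set \<Rightarrow> 'a \<times> 'b \<Rightarrow> real" where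
  "Gap f \<phi> g X Y zb = (SUP z \<in> X \<times> Y. gapQ f \<phi> g zb z)"

lemma Gap_attained:
  fixes X :: "'a::topological_space set" and Y :: "'b::topological_space set"
  assumes "compact X" "X \<noteq> {}" "compact Y" "Y \<noteq> {}"
    and f: "continuous_on X f" and g: "continuous_on Y g"
    and px: "\<And>y. y \<in> Y \<Longrightarrow> continuous_on X (\<lambda>x. \<phi> x y)"
    and py: "\<And>x. x \<in> X \<Longrightarrow> continuous_on Y (\<lambda>y. \<phi> x y)"
    and zb: "zb \<in> X \<times> Y"
  obtains z where "z \<in> X \<times> Y" "Gap f \<phi> g X Y zb = gapQ f \<phi> g zb z"
    "\<And>w. w \<in> X \<times> Y \<Longrightarrow> gapQ f \<phi> g zb w \<le> gapQ f \<phi> g zb z"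
proof -
  have x: "fst zb \<in> X" "snd zb \<in> Y"
    using zb by auto
  have "continuous_on X (\<lambda>x. lagr f \<phi> g x (snd zb))"
    unfolding lagr_def by (intro continuous_intros f px x)
  then obtain x' where x': "x' \<in> X" "\<And>u. u \<in> X \<Longrightarrow> lagr f \<phi> g x' (snd zb) \<le> lagr f \<phi> g u (snd zb)"
    using continuous_attains_inf[OF assms(1,2)] by metis
  have "continuous_on Y (\<lambda>y. lagr f \<phi> g (fst zb) y)"
    unfolding lagr_def by (intro continuous_intros g py x)
  then obtain y' where y': "y' \<in> Y" "\<And>u. u \<in> Y \<Longrightarrow> lagr f \<phi> g (fst zb) u \<le> lagr f \<phi> g (fst zb) y'"
    using continuous_attains_sup[OF assms(3,4)] by metis
  have z: "(x', y') \<in> X \<times> Y"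
    using x' y' by simp
  have ub: "gapQ f \<phi> g zb w \<le> gapQ f \<phi> g zb (x', y')" if "w \<in> X \<times> Y" for w
    using that x'(2)[of "fst w"] y'(2)[of "snd w"] unfolding gapQ_def by (auto intro: diff_mono)
  have "Gap f \<phi> g X Y zb = gapQ f \<phi> g zb (x', y')"
    unfolding Gap_def by (rule cSup_eq_maximum) (use z ub in auto)
  with z ub show thesis
    using that by blast
qed

text \<open>For compact nonempty \<^term>\<open>W\<close> the supremum in \<^const>\<open>diameter\<close> is attained (\<open>diameter_compact_attained\<close>).\<close>

definition Dsc :: "'a::metric_space set \<Rightarrow> real" where
  "Dsc W = diameter W / sqrt 2"

text \<open>
  \<open>ALPD X Y df dg dx dy \<beta> \<theta> \<tau> \<eta> K x y xb yb\<close>: the sequences \<open>x\<close>, \<open>y\<close>, \<open>xb\<close>, \<open>yb\<close> are the iterates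
  of \<^term>\<open>K\<close> steps of the method, where \<open>df\<close>, \<open>dg\<close>, \<open>dx\<close>, \<open>dy\<close> are the gradients of \<open>f\<close> and \<open>g\<close> and
  the partial gradients of \<open>\<phi>\<close>.  Each prox subproblem is strongly convex, so its minimizer is unique
  and \<^const>\<open>is_arg_min\<close> determines the iterates.  The entries \<open>xb 0\<close>, \<open>yb 0\<close> and the entries beyond
  \<open>K + 1\<close> are unconstrained.
\<close>

definition ALPD ::
    "'a::real_inner set \<Rightarrow> 'b::real_inner set \<Rightarrow> ('a \<Rightarrow> 'a) \<Rightarrow> ('b \<Rightarrow> 'b) \<Rightarrow>
     ('a \<Rightarrow> 'b \<Rightarrow> 'a) \<Rightarrow> ('a \<Rightarrow> 'b \<Rightarrow> 'b) \<Rightarrow>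
     (nat \<Rightarrow> real) \<Rightarrow> (nat \<Rightarrow> real) \<Rightarrow> (nat \<Rightarrow> real) \<Rightarrow> (nat \<Rightarrow> real) \<Rightarrow> nat \<Rightarrow>
     (nat \<Rightarrow> 'a) \<Rightarrow> (nat \<Rightarrow> 'b) \<Rightarrow> (nat \<Rightarrow> 'a) \<Rightarrow> (nat \<Rightarrow> 'b) \<Rightarrow> bool" where
  "ALPD X Y df dg dx dy \<beta> \<theta> \<tau> \<eta> K x y xb yb \<longleftrightarrow>
     xb 1 = x 1 \<and> x 0 = x 1 \<and> x 1 \<in> X \<and>
     yb 1 = y 1 \<and> y 0 = y 1 \<and> y 1 \<in> Y \<and>
     (\<forall>t\<in>{1..K}.
        let xu = (1 - inverse (\<beta> t)) *\<^sub>R xb t + inverse (\<beta> t) *\<^sub>R x t;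
            v = (1 + \<theta> t) *\<^sub>R dy (x t) (y t) - \<theta> t *\<^sub>R dy (x (t - 1)) (y (t - 1))
        in is_arg_min (\<lambda>u. (- v + dg (y t)) \<bullet> u + 1 / (2 * \<tau> t) * (norm (u - y t))\<^sup>2)
             (\<lambda>u. u \<in> Y) (y (t + 1)) \<and>
           is_arg_min (\<lambda>u. (df xu + dx (x t) (y (t + 1))) \<bullet> u + 1 / (2 * \<eta> t) * (norm (u - x t))\<^sup>2)
             (\<lambda>u. u \<in> X) (x (t + 1)) \<and>
           xb (t + 1) = (1 - inverse (\<beta> t)) *\<^sub>R xb t + inverse (\<beta> t) *\<^sub>R x (t + 1) \<and>
           yb (t + 1) = (1 - inverse (\<beta> t)) *\<^sub>R yb t + inverse (\<beta> t) *\<^sub>R y (t + 1))"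

end

theory Submission
  imports Defs
begin

text \<open>
  Fix a comparison point \<open>(u, v)\<close>. Smoothness, convexity and the optimality of the two prox steps
  bound \<open>\<beta>\<^sub>t Q\<^sub>t\<^sub>+\<^sub>1 - (\<beta>\<^sub>t - 1) Q\<^sub>t\<close> by telescoping squared distances, negative multiples of the squared
  step lengths, and the extrapolation error \<open>\<langle>p\<^sub>t\<^sub>+\<^sub>1, v - y\<^sub>t\<^sub>+\<^sub>1\<rangle> - \<theta>\<^sub>t \<langle>p\<^sub>t, v - y\<^sub>t\<^sub>+\<^sub>1\<rangle>\<close>, where \<open>p\<^sub>t\<close> is
  the increment of \<open>\<nabla>\<^sub>y \<phi>\<close> along the iterates. Weighting by \<open>\<gamma>\<^sub>t\<close> makes everything telescope since
  \<open>\<gamma>\<^sub>t \<theta>\<^sub>t = \<gamma>\<^sub>t\<^sub>-\<^sub>1\<close>; the leftover \<open>\<gamma>\<^sub>t\<^sub>-\<^sub>1 \<langle>p\<^sub>t, y\<^sub>t\<^sub>+\<^sub>1 - y\<^sub>t\<rangle>\<close> is split by Young's inequality between the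
  step lengths of two consecutive iterations. The slack \<open>L\<^sub>x\<^sub>x / 2\<close> in the monotonicity of \<open>\<gamma>\<^sub>t / \<eta>\<^sub>t\<close>
  costs at most \<open>L\<^sub>x\<^sub>x D\<^sub>X\<^sup>2 / 2\<close> per iteration.
\<close>

section \<open>Gradients relative to a convex set\<close>

lemma segment_mem:
  fixes S :: "'a::real_vector set"
  assumes "convex S" "u \<in> S" "u' \<in> S" "0 \<le> s" "s \<le> 1"
  shows "u + s *\<^sub>R (u' - u) \<in> S"
proof -
  have "u + s *\<^sub>R (u' - u) = (1 - s) *\<^sub>R u + s *\<^sub>R u'"
    by (simp add: algebra_simps)
  then show ?thesis
    using assms by (simp add: convex_alt)
qed

text \<open>The derivative within \<open>S\<close> restricts to the image of \<open>{0..1}\<close>,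
  where the chain rule applies. At the endpoints this is one-sided, which is all one has when
  \<open>u\<close> or \<open>u'\<close> lies on the boundary.\<close>

lemma gradient_on_segment:
  fixes S :: "'a::real_inner set"
  assumes S: "convex S" "u \<in> S" "u' \<in> S" and G: "gradient_on F G S" and s: "s \<in> {0..1::real}"
  shows "((\<lambda>s. F (u + s *\<^sub>R (u' - u))) has_real_derivative
           G (u + s *\<^sub>R (u' - u)) \<bullet> (u' - u)) (at s within {0..1})"
proof -
  let ?l = "\<lambda>s::real. u + s *\<^sub>R (u' - u)"
  have "(F has_derivative (\<lambda>h. G (?l s) \<bullet> h)) (at (?l s) within S)"
    using G segment_mem[OF S] s by (auto simp: gradient_on_def)
  then have "(F has_derivative (\<lambda>h. G (?l s) \<bullet> h)) (at (?l s) within ?l ` {0..1})"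
    by (rule has_derivative_subset) (use segment_mem[OF S] in auto)
  moreover have "(?l has_derivative (\<lambda>h. h *\<^sub>R (u' - u))) (at s within {0..1})"
    by (auto intro!: derivative_eq_intros)
  ultimately have "((\<lambda>s. F (?l s)) has_derivative (\<lambda>h. G (?l s) \<bullet> (h *\<^sub>R (u' - u)))) (at s within {0..1})"
    by (rule has_derivative_in_compose[rotated])
  then show ?thesis
    by (simp add: has_field_derivative_def mult_commute_abs)
qed

text \<open>Divide the convexity inequality on the segment by \<open>s\<close> and let
  \<open>s\<close> tend to 0. Only the one-sided derivative at 0 enters, so any choice of relative
  gradient works.\<close>

lemma convex_on_gradient_le:
  fixes S :: "'a::real_inner set"
  assumes F: "convex_on S F" and G: "gradient_on F G S" and u: "u \<in> S" "u' \<in> S"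
  shows "F u + G u \<bullet> (u' - u) \<le> F u'"
proof -
  let ?l = "\<lambda>s::real. u + s *\<^sub>R (u' - u)"
  have S: "convex S"
    using F by (rule convex_on_imp_convex)
  have "((\<lambda>s. F (?l s)) has_real_derivative G u \<bullet> (u' - u)) (at 0 within {0..1})"
    using gradient_on_segment[OF S u G, of 0] by simp
  then have "((\<lambda>s. (F (?l s) - F u) / s) \<longlongrightarrow> G u \<bullet> (u' - u)) (at 0 within {0..1})"
    by (simp add: has_field_derivative_iff)
  moreover have "\<forall>\<^sub>F s in at 0 within {0..1}. (F (?l s) - F u) / s \<le> F u' - F u"
    unfolding eventually_at_filter
  proof (intro always_eventually allI impI)
    fix s :: real
    assume s: "s \<noteq> 0" "s \<in> {0..1}"
    have "?l s = (1 - s) *\<^sub>R u + s *\<^sub>R u'"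
      by (simp add: algebra_simps)
    then have "F (?l s) \<le> (1 - s) * F u + s * F u'"
      using convex_onD[OF F, of s u u'] s u by simp
    then show "(F (?l s) - F u) / s \<le> F u' - F u"
      using s by (simp add: divide_simps algebra_simps)
  qed
  moreover have "at (0::real) within {0..1} \<noteq> bot"
    by (simp add: trivial_limit_within islimpt_Icc)
  ultimately have "G u \<bullet> (u' - u) \<le> F u' - F u"
    by (intro tendsto_upperbound)
  then show ?thesis by simp
qed

text \<open>An integration-free descent lemma: the mean value theorem is applied to \<open>F\<close>
  on the segment minus its quadratic model. The derivative of that difference is at most 0 by
  Cauchy-Schwarz and the Lipschitz bound.\<close>

lemma lipschitz_gradient_upper_bound:
  fixes S :: "'a::real_inner set"
  assumes S: "convex S" and G: "gradient_on F G S" and L: "L-lipschitz_on S G"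
    and u: "u \<in> S" "u' \<in> S"
  shows "F u' \<le> F u + G u \<bullet> (u' - u) + L / 2 * (norm (u' - u))\<^sup>2"
proof -
  define d where "d = u' - u"
  let ?h = "\<lambda>s::real. F (u + s *\<^sub>R d) - s * (G u \<bullet> d) - L / 2 * s\<^sup>2 * (norm d)\<^sup>2"
  let ?h' = "\<lambda>s::real. G (u + s *\<^sub>R d) \<bullet> d - G u \<bullet> d - L * s * (norm d)\<^sup>2"
  have "(?h has_real_derivative ?h' s) (at s within {0..1})" if "0 \<le> s" "s \<le> 1" for s
    using gradient_on_segment[OF S u G, of s] that
    by (auto intro!: derivative_eq_intros simp: d_def)
  then have "\<exists>s\<in>{0..1}. ?h 1 - ?h 0 = ?h' s * (1 - 0)"
    by (intro mvt_very_simple[of 0 1 ?h "\<lambda>s. (*) (?h' s)"])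
      (simp_all add: has_field_derivative_def)
  then obtain s where s: "0 \<le> s" "s \<le> 1" "?h 1 - ?h 0 = ?h' s"
    by auto
  have "(G (u + s *\<^sub>R d) - G u) \<bullet> d \<le> norm (G (u + s *\<^sub>R d) - G u) * norm d"
    by (rule norm_cauchy_schwarz)
  also have "\<dots> \<le> (L * norm (s *\<^sub>R d)) * norm d"
    using lipschitz_onD[OF L segment_mem[OF S u s(1,2)] u(1)]
    by (intro mult_right_mono) (simp_all add: dist_norm d_def)
  also have "\<dots> = L * s * (norm d)\<^sup>2"
    using s by (simp add: power2_eq_square)
  finally have "?h 1 - ?h 0 \<le> 0"
    unfolding s by (simp add: inner_diff_left)
  then show ?thesis
    by (simp add: d_def)
qed

section \<open>The ingredients of one iteration\<close>

text \<open>Testing minimality along the segment from \<open>w'\<close> to \<open>u\<close> gives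
  the variational inequality at \<open>w'\<close>; polarization turns its inner product into squared
  distances.\<close>

lemma prox_three_point:
  fixes S :: "'a::real_inner set"
  assumes S: "convex S" and r: "r > 0" and u: "u \<in> S"
    and min: "is_arg_min (\<lambda>u. c \<bullet> u + 1 / (2 * r) * (norm (u - w))\<^sup>2) (\<lambda>u. u \<in> S) w'"
  shows "c \<bullet> (w' - u) \<le>
    1 / (2 * r) * ((norm (u - w))\<^sup>2 - (norm (u - w'))\<^sup>2 - (norm (w' - w))\<^sup>2)"
proof -
  define d where "d = u - w'"
  let ?a = "c \<bullet> d + 1 / r * ((w' - w) \<bullet> d)"
  let ?b = "1 / (2 * r) * (d \<bullet> d)"
  have w': "w' \<in> S"
    using min by (simp add: is_arg_min_def)
  \<comment> \<open>\<open>?a\<close> is the directional derivative of the objective at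
    \<open>w'\<close> along \<open>d\<close>, and \<open>s * ?b\<close> is the quadratic remainder
    after division by \<open>s\<close>.\<close>
  have *: "0 \<le> ?a + s * ?b" if s: "0 < s" "s \<le> 1" for s
  proof -
    have "w' + s *\<^sub>R d \<in> S"
      using segment_mem[OF S w' u, of s] s by (simp add: d_def)
    then have "c \<bullet> w' + 1 / (2 * r) * (norm (w' - w))\<^sup>2 \<le>
        c \<bullet> (w' + s *\<^sub>R d) + 1 / (2 * r) * (norm (w' + s *\<^sub>R d - w))\<^sup>2"
      using min by (auto simp: is_arg_min_def not_less)
    moreover have "(norm (w' + s *\<^sub>R d - w))\<^sup>2 =
        (norm (w' - w))\<^sup>2 + 2 * s * ((w' - w) \<bullet> d) + s\<^sup>2 * (d \<bullet> d)"
      unfolding power2_norm_eq_inner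
      by (simp add: inner_simps inner_commute power2_eq_square algebra_simps)
    ultimately have "0 \<le> s * (c \<bullet> d) + 1 / (2 * r) * (2 * s * ((w' - w) \<bullet> d) + s\<^sup>2 * (d \<bullet> d))"
      by (simp add: inner_add_right distrib_left add.assoc)
    also have "\<dots> = s * (?a + s * ?b)"
      using r by (simp add: field_simps power2_eq_square)
    finally have "0 \<le> s * (?a + s * ?b)" .
    then show ?thesis
      using s by (simp add: zero_le_mult_iff)
  qed
  have "((\<lambda>s. ?a + s * ?b) \<longlongrightarrow> ?a + 0 * ?b) (at_right 0)"
    by (intro tendsto_intros)
  moreover have "\<forall>\<^sub>F s in at_right 0. 0 \<le> ?a + s * ?b"
    using eventually_at_right_real[OF zero_less_one]
    by eventually_elim (use * in auto)
  ultimately have "0 \<le> ?a + 0 * ?b"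
    by (intro tendsto_lowerbound) auto
  moreover have "2 * ((w' - w) \<bullet> d) = (norm (u - w))\<^sup>2 - (norm (u - w'))\<^sup>2 - (norm (w' - w))\<^sup>2"
    by (simp add: d_def power2_norm_eq_inner inner_simps inner_commute)
  ultimately show ?thesis
    using r by (simp add: d_def inner_simps field_simps)
qed

lemma convex_on_average:
  fixes S :: "'a::real_vector set"
  assumes F: "convex_on S F" and b: "b \<ge> 1" and "u \<in> S" "w \<in> S"
  shows "b * F ((1 - inverse b) *\<^sub>R u + inverse b *\<^sub>R w) \<le> (b - 1) * F u + F w"
proof -
  have "F ((1 - inverse b) *\<^sub>R u + inverse b *\<^sub>R w) \<le> (1 - inverse b) * F u + inverse b * F w"
    using assms by (intro convex_onD[OF F]) (auto simp: field_simps)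
  then have "b * F ((1 - inverse b) *\<^sub>R u + inverse b *\<^sub>R w) \<le> b * ((1 - inverse b) * F u + inverse b * F w)"
    using b by (intro mult_left_mono) auto
  also have "\<dots> = (b - 1) * F u + F w"
    using b by (simp add: field_simps)
  finally show ?thesis .
qed

text \<open>The new average and \<open>m\<close> differ by \<open>(w' - w) / b\<close>, so the
  smoothness error, multiplied by \<open>b\<close>, is only \<open>L / (2 * b)\<close> times the
  squared step. Tangent inequalities at \<open>m\<close> towards \<open>u\<close> and
  \<open>z\<close> absorb the linear term except for \<open>G m \<bullet> (w' - z)\<close>, which is
  left for the prox inequality.\<close>

lemma accelerated_gradient_step:
  fixes S :: "'a::real_inner set" and b :: real
  assumes F: "convex_on S F" and G: "gradient_on F G S" and L: "L-lipschitz_on S G"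
    and b: "b \<ge> 1" and mem: "u \<in> S" "w \<in> S" "w' \<in> S" "z \<in> S"
  defines "m \<equiv> (1 - inverse b) *\<^sub>R u + inverse b *\<^sub>R w"
  shows "b * F ((1 - inverse b) *\<^sub>R u + inverse b *\<^sub>R w') \<le>
    (b - 1) * F u + F z + G m \<bullet> (w' - z) + L / (2 * b) * (norm (w' - w))\<^sup>2"
proof -
  define u' where "u' = (1 - inverse b) *\<^sub>R u + inverse b *\<^sub>R w'"
  have S: "convex S"
    using F by (rule convex_on_imp_convex)
  have avg: "(1 - inverse b) *\<^sub>R u + inverse b *\<^sub>R v \<in> S" if "v \<in> S" for v
    using convexD_alt[OF S mem(1) that, of "inverse b"] b by (simp add: field_simps)
  have m: "m \<in> S" and u': "u' \<in> S"
    using avg mem by (auto simp: m_def u'_def)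
  have "b * F u' \<le> b * (F m + G m \<bullet> (u' - m) + L / 2 * (norm (u' - m))\<^sup>2)"
    using lipschitz_gradient_upper_bound[OF S G L m u'] b by simp
  also have "(norm (u' - m))\<^sup>2 = (norm (w' - w))\<^sup>2 / b\<^sup>2"
  proof -
    have "u' - m = inverse b *\<^sub>R (w' - w)"
      by (simp add: u'_def m_def algebra_simps)
    then show ?thesis
      using b by (simp add: power_mult_distrib divide_inverse mult.commute power_inverse)
  qed
  also have "b * (F m + G m \<bullet> (u' - m) + L / 2 * ((norm (w' - w))\<^sup>2 / b\<^sup>2)) =
      b * F m + G m \<bullet> (b *\<^sub>R (u' - m)) + L / (2 * b) * (norm (w' - w))\<^sup>2"
    using b by (simp add: distrib_left power2_eq_square del: scaleR_right_diff_distrib)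
  also have "b *\<^sub>R (u' - m) = (b - 1) *\<^sub>R (u - m) + (z - m) + (w' - z)"
  proof -
    have "b *\<^sub>R u' = (b - 1) *\<^sub>R u + w'"
      using b by (simp add: u'_def scaleR_add_right algebra_simps)
    then show ?thesis
      by (simp add: algebra_simps)
  qed
  also have "b * F m + G m \<bullet> ((b - 1) *\<^sub>R (u - m) + (z - m) + (w' - z)) =
      (b - 1) * (F m + G m \<bullet> (u - m)) + (F m + G m \<bullet> (z - m)) + G m \<bullet> (w' - z)"
    by (simp add: inner_add_right algebra_simps)
  finally have "b * F u' \<le> (b - 1) * (F m + G m \<bullet> (u - m)) + (F m + G m \<bullet> (z - m)) +
      G m \<bullet> (w' - z) + L / (2 * b) * (norm (w' - w))\<^sup>2" .
  moreover have "(b - 1) * (F m + G m \<bullet> (u - m)) \<le> (b - 1) * F u"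
    using convex_on_gradient_le[OF F G m mem(1)] b by (intro mult_left_mono) auto
  moreover have "F m + G m \<bullet> (z - m) \<le> F z"
    by (rule convex_on_gradient_le[OF F G m mem(4)])
  ultimately show ?thesis
    unfolding u'_def by linarith
qed

text \<open>Both bounds are expanded at the old point \<open>w\<close>: smoothness towards
  \<open>w'\<close>, strong convexity towards \<open>z\<close>. Hence the gain involves the old
  distance \<open>norm (z - w)\<close>.\<close>

lemma strongly_convex_gradient_step:
  fixes S :: "'a::real_inner set"
  assumes S: "convex S" and G: "gradient_on F G S" and L: "L-lipschitz_on S G"
    and sc: "strongly_convex_on \<mu> F G S" and mem: "w \<in> S" "w' \<in> S" "z \<in> S"
  shows "F w' - F z \<le> G w \<bullet> (w' - z) + L / 2 * (norm (w' - w))\<^sup>2 - \<mu> / 2 * (norm (z - w))\<^sup>2"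
proof -
  have "F w' \<le> F w + G w \<bullet> (w' - w) + L / 2 * (norm (w' - w))\<^sup>2"
    by (rule lipschitz_gradient_upper_bound[OF S G L mem(1,2)])
  moreover have "F z - F w - G w \<bullet> (z - w) \<ge> \<mu> / 2 * (norm (z - w))\<^sup>2"
    using sc mem by (simp add: strongly_convex_on_def)
  ultimately show ?thesis
    by (simp add: inner_diff_right)
qed

text \<open>Averaging the tangent inequalities at the convex combination \<open>m\<close> cancels
  the linear terms. This supplies Jensen's inequality for \<open>g\<close>, whose convexity is given
  only in gradient form.\<close>

lemma strongly_convex_imp_convex_on:
  fixes S :: "'a::real_inner set"
  assumes S: "convex S" and sc: "strongly_convex_on \<mu> F G S" and \<mu>: "\<mu> \<ge> 0"
  shows "convex_on S F"
proof (rule convex_onI[OF _ S])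
  fix t :: real and u w
  assume t: "0 < t" "t < 1" and mem: "u \<in> S" "w \<in> S"
  define m where "m = (1 - t) *\<^sub>R u + t *\<^sub>R w"
  have "m \<in> S"
    using convexD_alt[OF S mem, of t] t by (simp add: m_def)
  then have tangent: "F m + G m \<bullet> (z - m) \<le> F z" if "z \<in> S" for z
    using sc \<mu> that mult_nonneg_nonneg[of "\<mu> / 2" "(norm (z - m))\<^sup>2"]
    unfolding strongly_convex_on_def by (smt (verit) divide_nonneg_nonneg zero_le_power2)
  have "(1 - t) * (F m + G m \<bullet> (u - m)) + t * (F m + G m \<bullet> (w - m)) \<le> (1 - t) * F u + t * F w"
    using tangent mem t by (intro add_mono mult_left_mono) auto
  moreover have "(1 - t) * (F m + G m \<bullet> (u - m)) + t * (F m + G m \<bullet> (w - m)) =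
      F m + G m \<bullet> ((1 - t) *\<^sub>R (u - m) + t *\<^sub>R (w - m))"
    by (simp add: inner_add_right algebra_simps)
  moreover have "(1 - t) *\<^sub>R (u - m) + t *\<^sub>R (w - m) = 0"
    by (simp add: m_def algebra_simps)
  ultimately show "F ((1 - t) *\<^sub>R u + t *\<^sub>R w) \<le> (1 - t) * F u + t * F w"
    by (simp add: m_def)
qed

text \<open>Go from \<open>\<phi> x' v\<close> to \<open>\<phi> u y'\<close> through
  \<open>\<phi> x' y'\<close> and \<open>\<phi> w y'\<close>, using concavity, smoothness and
  convexity in turn. The \<open>x\<close>-gradient then sits at \<open>(w, y')\<close>, exactly
  where the \<open>x\<close>-step of the method evaluates it.\<close>

lemma coupling_step:
  fixes X :: "'a::real_inner set" and Y :: "'b::real_inner set"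
  assumes X: "convex_on X (\<lambda>u. \<phi> u y')" "gradient_on (\<lambda>u. \<phi> u y') (\<lambda>u. dx u y') X"
      "L-lipschitz_on X (\<lambda>u. dx u y')"
    and Y: "concave_on Y (\<phi> x')" "gradient_on (\<phi> x') (dy x') Y"
    and mem: "w \<in> X" "x' \<in> X" "u \<in> X" "y' \<in> Y" "v \<in> Y"
  shows "\<phi> x' v - \<phi> u y' \<le>
    dy x' y' \<bullet> (v - y') + dx w y' \<bullet> (x' - u) + L / 2 * (norm (x' - w))\<^sup>2"
proof -
  have "gradient_on (\<lambda>v. - \<phi> x' v) (\<lambda>v. - dy x' v) Y"
    using Y(2) by (auto simp: gradient_on_def intro!: derivative_eq_intros)
  from convex_on_gradient_le[OF Y(1)[unfolded concave_on_def] this mem(4,5)]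
  have "\<phi> x' v \<le> \<phi> x' y' + dy x' y' \<bullet> (v - y')"
    by simp
  moreover have "\<phi> x' y' \<le> \<phi> w y' + dx w y' \<bullet> (x' - w) + L / 2 * (norm (x' - w))\<^sup>2"
    using lipschitz_gradient_upper_bound[OF convex_on_imp_convex[OF X(1)] X(2,3) mem(1,2)] by simp
  moreover have "\<phi> w y' + dx w y' \<bullet> (u - w) \<le> \<phi> u y'"
    using convex_on_gradient_le[OF X(1,2) mem(1,3)] by simp
  ultimately show ?thesis
    by (simp add: inner_diff_right)
qed

lemma Young_inner:
  fixes p d :: "'a::real_inner"
  assumes "r > 0"
  shows "p \<bullet> d \<le> r * (norm p)\<^sup>2 + 1 / (4 * r) * (norm d)\<^sup>2"
proof -
  have "0 \<le> 1 / r * (norm (r *\<^sub>R p - (1 / 2) *\<^sub>R d))\<^sup>2"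
    using assms by simp
  also have "\<dots> = r * (norm p)\<^sup>2 + 1 / (4 * r) * (norm d)\<^sup>2 - p \<bullet> d"
    using assms by (simp add: power2_norm_eq_inner inner_simps inner_commute field_simps)
  finally show ?thesis by simp
qed

text \<open>Triangle inequality through \<open>h x y'\<close>, then the square of a sum is at most
  twice the sum of squares. This is the source of the factor 2 before the squares of
  \<open>Lxy\<close> and \<open>Lyy\<close> in the step-size conditions.\<close>

lemma cross_lipschitz_sq:
  fixes h :: "'a::metric_space \<Rightarrow> 'b::metric_space \<Rightarrow> 'c::real_normed_vector"
  assumes "a-lipschitz_on X (\<lambda>u. h u y')" "b-lipschitz_on Y (h x)"
    and "x \<in> X" "x' \<in> X" "y \<in> Y" "y' \<in> Y"
  shows "(norm (h x' y' - h x y))\<^sup>2 \<le> 2 * a\<^sup>2 * (dist x' x)\<^sup>2 + 2 * b\<^sup>2 * (dist y' y)\<^sup>2"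
proof -
  have "norm (h x' y' - h x y) \<le> dist (h x' y') (h x y') + dist (h x y') (h x y)"
    unfolding dist_norm[symmetric] by (rule dist_triangle)
  also have "\<dots> \<le> a * dist x' x + b * dist y' y"
    using assms by (intro add_mono lipschitz_onD)
  finally have "(norm (h x' y' - h x y))\<^sup>2 \<le> (a * dist x' x + b * dist y' y)\<^sup>2"
    by (rule power_mono) simp
  also have "\<dots> \<le> 2 * (a * dist x' x)\<^sup>2 + 2 * (b * dist y' y)\<^sup>2"
    using zero_le_power2[of "a * dist x' x - b * dist y' y"]
    by (simp add: power2_eq_square algebra_simps)
  finally show ?thesis
    by (simp add: power_mult_distrib)
qed

lemma norm_sq_le_Dsc:
  fixes W :: "'a::real_normed_vector set"
  assumes "bounded W" "u \<in> W" "w \<in> W"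
  shows "(norm (u - w))\<^sup>2 \<le> 2 * (Dsc W)\<^sup>2"
proof -
  have "(norm (u - w))\<^sup>2 \<le> (diameter W)\<^sup>2"
    using diameter_bounded_bound[OF assms] by (intro power_mono) (auto simp: dist_norm)
  then show ?thesis
    by (simp add: Dsc_def power_divide)
qed

section \<open>The gap estimate\<close>

theorem theorem4p3:
  fixes X :: "(real ^ 'n) set" and Y :: "(real ^ 'm) set"
    and f :: "real ^ 'n \<Rightarrow> real" and g :: "real ^ 'm \<Rightarrow> real"
    and \<phi> :: "real ^ 'n \<Rightarrow> real ^ 'm \<Rightarrow> real"
    and df :: "real ^ 'n \<Rightarrow> real ^ 'n" and dg :: "real ^ 'm \<Rightarrow> real ^ 'm"
    and dx :: "real ^ 'n \<Rightarrow> real ^ 'm \<Rightarrow> real ^ 'n" and dy :: "real ^ 'n \<Rightarrow> real ^ 'm \<Rightarrow> real ^ 'm"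
    and Lf Lg Lxx Lyy Lxy \<mu>g :: real
    and \<beta> \<gamma> \<theta> \<tau> \<eta> :: "nat \<Rightarrow> real"
    and K :: nat
    and x xb :: "nat \<Rightarrow> real ^ 'n" and y yb :: "nat \<Rightarrow> real ^ 'm"
  assumes X: "X \<noteq> {}" "compact X" "convex X"
    and Y: "Y \<noteq> {}" "compact Y" "convex Y"
    and f: "convex_on X f" "gradient_on f df X" "Lf-lipschitz_on X df"
    and g: "gradient_on g dg Y" "Lg-lipschitz_on Y dg" "\<mu>g > 0" "strongly_convex_on \<mu>g g dg Y"
    and \<phi>_diff: "(\<lambda>z. \<phi> (fst z) (snd z)) differentiable_on X \<times> Y"
      "\<And>v. v \<in> Y \<Longrightarrow> gradient_on (\<lambda>u. \<phi> u v) (\<lambda>u. dx u v) X"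
      "\<And>u. u \<in> X \<Longrightarrow> gradient_on (\<lambda>v. \<phi> u v) (\<lambda>v. dy u v) Y"
    and \<phi>_convex: "\<And>v. v \<in> Y \<Longrightarrow> convex_on X (\<lambda>u. \<phi> u v)"
    and \<phi>_concave: "\<And>u. u \<in> X \<Longrightarrow> concave_on Y (\<lambda>v. \<phi> u v)"
    and Lxx: "\<And>v. v \<in> Y \<Longrightarrow> Lxx-lipschitz_on X (\<lambda>u. dx u v)"
    and Lyy: "\<And>u. u \<in> X \<Longrightarrow> Lyy-lipschitz_on Y (\<lambda>v. dy u v)"
    and Lxy: "\<And>v. v \<in> Y \<Longrightarrow> Lxy-lipschitz_on X (\<lambda>u. dy u v)"
    and pos: "\<And>t. t \<ge> 1 \<Longrightarrow> \<beta> t > 0 \<and> \<gamma> t > 0 \<and> \<tau> t > 0 \<and> \<eta> t > 0"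
    and \<beta>1: "\<beta> 1 = 1"
    and \<beta>_step: "\<And>t. t \<ge> 1 \<Longrightarrow> \<beta> (t + 1) - 1 = \<beta> t * \<theta> (t + 1)"
    and \<theta>_eq: "\<And>t. t \<ge> 2 \<Longrightarrow> \<theta> t = \<gamma> (t - 1) / \<gamma> t"
    and \<theta>_bound: "\<And>t. t \<ge> 2 \<Longrightarrow> 0 \<le> \<theta> t \<and> \<theta> t \<le> \<tau> (t - 1) / \<tau> t"
    and \<eta>_cond: "\<And>t. t \<ge> 1 \<Longrightarrow> 1 / (2 * \<eta> t) - Lf / (2 * \<beta> t) - 2 * Lxy\<^sup>2 * \<tau> t \<ge> Lxx / 2"
    and \<tau>_cond: "\<And>t. t \<ge> 1 \<Longrightarrow> 1 / (4 * \<tau> t) - Lg / 2 - 2 * Lyy\<^sup>2 * \<tau> t \<ge> 0"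
    and \<tau>_mono: "\<And>t. t \<ge> 2 \<Longrightarrow> \<gamma> t * (1 / \<tau> t - \<mu>g) \<le> \<gamma> (t - 1) / \<tau> (t - 1)"
    and \<eta>_mono: "\<And>t. t \<ge> 2 \<Longrightarrow> \<gamma> t / \<eta> t \<le> \<gamma> (t - 1) / \<eta> (t - 1) + Lxx / 2"
    and K: "K \<ge> 1"
    and run: "ALPD X Y df dg dx dy \<beta> \<theta> \<tau> \<eta> K x y xb yb"
  shows "Gap f \<phi> g X Y (xb (K + 1), yb (K + 1))
    \<le> (\<gamma> 1 / (\<beta> K * \<gamma> K * \<eta> 1) + real K * Lxx / (\<beta> K * \<gamma> K)) * (Dsc X)\<^sup>2
      + \<gamma> 1 / (\<beta> K * \<gamma> K * \<tau> 1) * (Dsc Y)\<^sup>2"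
proof -

  \<comment> \<open>The iterates: update rules, feasibility and gradient increments\<close>
  note pos' = pos[THEN conjunct1] pos[THEN conjunct2, THEN conjunct1]
    pos[THEN conjunct2, THEN conjunct2, THEN conjunct1]
    pos[THEN conjunct2, THEN conjunct2, THEN conjunct2]
  define xu where "xu t = (1 - inverse (\<beta> t)) *\<^sub>R xb t + inverse (\<beta> t) *\<^sub>R x t" for t
  define p where "p t = dy (x t) (y t) - dy (x (t - 1)) (y (t - 1))" for t
  have init: "xb 1 = x 1" "x 0 = x 1" "x 1 \<in> X" "yb 1 = y 1" "y 0 = y 1" "y 1 \<in> Y"
    using run by (simp_all add: ALPD_def)
  have ystep: "is_arg_min (\<lambda>u. (- (dy (x t) (y t) + \<theta> t *\<^sub>R p t) + dg (y t)) \<bullet> u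
                  + 1 / (2 * \<tau> t) * (norm (u - y t))\<^sup>2) (\<lambda>u. u \<in> Y) (y (t + 1))"
    and xstep: "is_arg_min (\<lambda>u. (df (xu t) + dx (x t) (y (t + 1))) \<bullet> u
                  + 1 / (2 * \<eta> t) * (norm (u - x t))\<^sup>2) (\<lambda>u. u \<in> X) (x (t + 1))"
    and xbstep: "xb (t + 1) = (1 - inverse (\<beta> t)) *\<^sub>R xb t + inverse (\<beta> t) *\<^sub>R x (t + 1)"
    and ybstep: "yb (t + 1) = (1 - inverse (\<beta> t)) *\<^sub>R yb t + inverse (\<beta> t) *\<^sub>R y (t + 1)"
    if "1 \<le> t" "t \<le> K" for t
  proof -
    have v: "(1 + \<theta> t) *\<^sub>R dy (x t) (y t) - \<theta> t *\<^sub>R dy (x (t - 1)) (y (t - 1)) =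
        dy (x t) (y t) + \<theta> t *\<^sub>R p t" for t
      by (simp add: p_def algebra_simps)
    show
      "is_arg_min (\<lambda>u. (- (dy (x t) (y t) + \<theta> t *\<^sub>R p t) + dg (y t)) \<bullet> u
          + 1 / (2 * \<tau> t) * (norm (u - y t))\<^sup>2) (\<lambda>u. u \<in> Y) (y (t + 1))"
      "is_arg_min (\<lambda>u. (df (xu t) + dx (x t) (y (t + 1))) \<bullet> u
          + 1 / (2 * \<eta> t) * (norm (u - x t))\<^sup>2) (\<lambda>u. u \<in> X) (x (t + 1))"
      "xb (t + 1) = (1 - inverse (\<beta> t)) *\<^sub>R xb t + inverse (\<beta> t) *\<^sub>R x (t + 1)"
      "yb (t + 1) = (1 - inverse (\<beta> t)) *\<^sub>R yb t + inverse (\<beta> t) *\<^sub>R y (t + 1)"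
      using run that unfolding ALPD_def Let_def v xu_def by simp_all
  qed
  \<comment> \<open>This makes \<open>inverse (\<beta> t)\<close> a convex weight, so the averaged
    points stay feasible.\<close>
  have \<beta>_ge: "\<beta> t \<ge> 1" if t: "t \<ge> 1" for t
  proof (cases "t = 1")
    case False
    then have "t - 1 \<ge> 1" "t - 1 + 1 = t" "t \<ge> 2"
      using t by auto
    then show ?thesis
      using \<beta>_step[of "t - 1"] \<theta>_bound[of t] pos'(1)[of "t - 1"]
        mult_nonneg_nonneg[of "\<beta> (t - 1)" "\<theta> t"] by (metis diff_ge_0_iff_ge less_imp_le)
  qed (use \<beta>1 in simp)
  have mem: "x t \<in> X \<and> y t \<in> Y \<and> xb t \<in> X \<and> yb t \<in> Y" if "1 \<le> t" "t \<le> K + 1" for t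
    using that
  proof (induction t rule: dec_induct)
    case base
    then show ?case using init by simp
  next
    case (step t)
    have t: "1 \<le> t" "t \<le> K" using step by auto
    have new: "x (t + 1) \<in> X" "y (t + 1) \<in> Y"
      using xstep[OF t] ystep[OF t] by (simp_all add: is_arg_min_def)
    have "0 \<le> inverse (\<beta> t)" "inverse (\<beta> t) \<le> 1"
      using \<beta>_ge[OF t(1)] by (auto simp: field_simps)
    then have "xb (t + 1) \<in> X" "yb (t + 1) \<in> Y"
      unfolding xbstep[OF t] ybstep[OF t]
      using convexD_alt[OF X(3) _ new(1)] convexD_alt[OF Y(3) _ new(2)] step t by auto
    with new show ?case by simp
  qed
  have g_convex: "convex_on Y g"
    using strongly_convex_imp_convex_on[OF Y(3) g(4)] g(3) by simp
  have Lxx_nonneg: "Lxx \<ge> 0"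
    using Lxx init(6) lipschitz_on_nonneg by blast
  have p_bound: "(norm (p (t + 1)))\<^sup>2 \<le>
      2 * Lxy\<^sup>2 * (norm (x (t + 1) - x t))\<^sup>2 + 2 * Lyy\<^sup>2 * (norm (y (t + 1) - y t))\<^sup>2"
    if t: "1 \<le> t" "t \<le> K" for t
    using cross_lipschitz_sq[of Lxy X dy "y (t + 1)" Lyy Y "x t" "x (t + 1)" "y t"]
      mem[of t] mem[of "t + 1"] Lxy Lyy t by (simp add: p_def dist_norm)

  \<comment> \<open>The bound against a fixed comparison point\<close>
  have main: "\<beta> K * \<gamma> K * gapQ f \<phi> g (xb (K + 1), yb (K + 1)) (u, v) \<le>
      (\<gamma> 1 / \<eta> 1 + real K * Lxx) * (Dsc X)\<^sup>2 + \<gamma> 1 / \<tau> 1 * (Dsc Y)\<^sup>2"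
    if u: "u \<in> X" and v: "v \<in> Y" for u v
  proof -
    define Q where "Q t = gapQ f \<phi> g (xb t, yb t) (u, v)" for t
    define A where "A t = (norm (u - x t))\<^sup>2" for t
    define B where "B t = (norm (v - y t))\<^sup>2" for t
    define R where "R t = (norm (x (t + 1) - x t))\<^sup>2" for t
    define S where "S t = (norm (y (t + 1) - y t))\<^sup>2" for t
    define P where "P t = (norm (p t))\<^sup>2" for t
    \<comment> \<open>The negative terms in \<open>R t\<close> and \<open>S t\<close> from the two
      prox steps pay for the smoothness errors and for \<open>\<tau> t * P (t + 1)\<close>. The
      quarter \<open>1 / (4 * \<tau> t) * S t\<close> is kept back for Young's inequality on
      \<open>p t \<bullet> (y (t + 1) - y t)\<close>.\<close>
    have one_step: "\<beta> t * Q (t + 1) \<le> (\<beta> t - 1) * Q t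
        + 1 / (2 * \<eta> t) * (A t - A (t + 1))
        + (1 / (2 * \<tau> t) - \<mu>g / 2) * B t - 1 / (2 * \<tau> t) * B (t + 1)
        + p (t + 1) \<bullet> (v - y (t + 1)) - \<theta> t * (p t \<bullet> (v - y t))
        + \<theta> t * (p t \<bullet> (y (t + 1) - y t)) - \<tau> t * P (t + 1) - 1 / (4 * \<tau> t) * S t"
      if t: "1 \<le> t" "t \<le> K" for t
    proof -
      have m: "x t \<in> X" "y t \<in> Y" "xb t \<in> X" "yb t \<in> Y" "x (t + 1) \<in> X" "y (t + 1) \<in> Y"
        using mem[of t] mem[of "t + 1"] t by auto
      have b: "\<beta> t \<ge> 1" and \<tau>: "\<tau> t > 0" and \<eta>: "\<eta> t > 0"
        using \<beta>_ge pos' t by auto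
      have 1: "\<beta> t * f (xb (t + 1)) \<le> (\<beta> t - 1) * f (xb t) + f u + df (xu t) \<bullet> (x (t + 1) - u)
          + Lf / (2 * \<beta> t) * R t"
        unfolding xbstep[OF t] R_def xu_def
        by (rule accelerated_gradient_step[OF f b m(3,1,5) u])
      have 2: "\<beta> t * g (yb (t + 1)) \<le> (\<beta> t - 1) * g (yb t) + g (y (t + 1))"
        unfolding ybstep[OF t] by (rule convex_on_average[OF g_convex b m(4,6)])
      have 3: "g (y (t + 1)) - g v \<le> dg (y t) \<bullet> (y (t + 1) - v) + Lg / 2 * S t - \<mu>g / 2 * B t"
        unfolding S_def B_def by (rule strongly_convex_gradient_step[OF Y(3) g(1,2,4) m(2,6) v])
      have 4: "\<beta> t * \<phi> (xb (t + 1)) v \<le> (\<beta> t - 1) * \<phi> (xb t) v + \<phi> (x (t + 1)) v"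
        unfolding xbstep[OF t] by (rule convex_on_average[OF \<phi>_convex[OF v] b m(3,5)])
      have 5: "\<beta> t * (- \<phi> u (yb (t + 1))) \<le> (\<beta> t - 1) * (- \<phi> u (yb t)) + (- \<phi> u (y (t + 1)))"
        unfolding ybstep[OF t]
        by (rule convex_on_average[OF \<phi>_concave[OF u, unfolded concave_on_def] b m(4,6)])
      have 6: "\<phi> (x (t + 1)) v - \<phi> u (y (t + 1)) \<le>
          dy (x (t + 1)) (y (t + 1)) \<bullet> (v - y (t + 1)) + dx (x t) (y (t + 1)) \<bullet> (x (t + 1) - u)
          + Lxx / 2 * R t"
        unfolding R_def
        by (rule coupling_step[OF \<phi>_convex \<phi>_diff(2) Lxx \<phi>_concave \<phi>_diff(3)]) (use m u v in auto)
      have 7: "(- (dy (x t) (y t) + \<theta> t *\<^sub>R p t) + dg (y t)) \<bullet> (y (t + 1) - v) \<le>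
          1 / (2 * \<tau> t) * (B t - B (t + 1) - S t)"
        unfolding B_def S_def by (rule prox_three_point[OF Y(3) \<tau> v ystep[OF t]])
      have 8: "(df (xu t) + dx (x t) (y (t + 1))) \<bullet> (x (t + 1) - u) \<le>
          1 / (2 * \<eta> t) * (A t - A (t + 1) - R t)"
        unfolding A_def R_def by (rule prox_three_point[OF X(3) \<eta> u xstep[OF t]])
      \<comment> \<open>Writing \<open>v - y (t + 1)\<close> as
        \<open>(v - y t) - (y (t + 1) - y t)\<close> in the \<open>\<theta> t\<close> term isolates
        the part that telescopes.\<close>
      have 9: "dy (x (t + 1)) (y (t + 1)) \<bullet> (v - y (t + 1))
            + (dy (x t) (y t) + \<theta> t *\<^sub>R p t) \<bullet> (y (t + 1) - v) =
          p (t + 1) \<bullet> (v - y (t + 1)) - \<theta> t * (p t \<bullet> (v - y t))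
            + \<theta> t * (p t \<bullet> (y (t + 1) - y t))"
        unfolding p_def[of "t + 1"] by (simp add: inner_simps algebra_simps)
      have "\<tau> t * P (t + 1) \<le> \<tau> t * (2 * Lxy\<^sup>2 * R t + 2 * Lyy\<^sup>2 * S t)"
        using p_bound[OF t] \<tau> unfolding P_def R_def S_def by (intro mult_left_mono) auto
      moreover have "2 * Lxy\<^sup>2 * \<tau> t * R t \<le> (1 / (2 * \<eta> t) - Lf / (2 * \<beta> t) - Lxx / 2) * R t"
        using \<eta>_cond[OF t(1)] by (intro mult_right_mono) (auto simp: R_def)
      moreover have "2 * Lyy\<^sup>2 * \<tau> t * S t \<le> (1 / (2 * \<tau> t) - Lg / 2 - 1 / (4 * \<tau> t)) * S t"
        using \<tau>_cond[OF t(1)] by (intro mult_right_mono) (auto simp: S_def)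
      ultimately have 10: "\<tau> t * P (t + 1) \<le>
          (1 / (2 * \<eta> t) - Lf / (2 * \<beta> t) - Lxx / 2) * R t
          + (1 / (2 * \<tau> t) - Lg / 2 - 1 / (4 * \<tau> t)) * S t"
        by (simp add: algebra_simps)
      \<comment> \<open>On adding the facts, the inner products with \<open>df\<close>,
        \<open>dg\<close> and \<open>dx\<close> cancel between the function bounds and the prox
        inequalities.\<close>
      show ?thesis
        using 1 2 3 4 5 6 7 8 9 10
        unfolding Q_def gapQ_def lagr_def fst_conv snd_conv
        by (simp only: inner_add_left inner_minus_left ring_distribs left_diff_distrib
            right_diff_distrib mult_minus_right mult_1_left)
    qed
    \<comment> \<open>The last two terms are not estimated yet: the inner product cancels in the
      next iteration, and \<open>- \<gamma> t * \<tau> t * P (t + 1)\<close> pays for Young's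
      inequality there. The count is \<open>real t - 1\<close> because the slack in
      \<open>\<eta>_mono\<close> first occurs at index 2.\<close>
    have potential: "\<gamma> t * \<beta> t * Q (t + 1) \<le>
        \<gamma> 1 * (1 / (2 * \<eta> 1)) * A 1 + \<gamma> 1 * (1 / (2 * \<tau> 1)) * B 1 + (real t - 1) * (Lxx / 2 * (Dsc X)\<^sup>2)
        - \<gamma> t * (1 / (2 * \<eta> t)) * A (t + 1) - \<gamma> t * (1 / (2 * \<tau> t)) * B (t + 1)
        + \<gamma> t * (p (t + 1) \<bullet> (v - y (t + 1))) - \<gamma> t * \<tau> t * P (t + 1)"
      if "1 \<le> t" "t \<le> K" for t
      using that
    proof (induction t rule: dec_induct)
      case base
      \<comment> \<open>The coinciding start points remove every term with
        \<open>\<theta> 1\<close>; \<open>\<beta> 1 = 1\<close> removes \<open>Q 1\<close>.\<close>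
      have p1: "p 1 = 0"
        using init by (simp add: p_def)
      have "0 \<le> \<mu>g / 2 * B 1" "0 \<le> 1 / (4 * \<tau> 1) * S 1"
        using g(3) pos[of 1] by (auto simp: B_def S_def)
      then have "\<beta> 1 * Q (1 + 1) \<le> 1 / (2 * \<eta> 1) * (A 1 - A (1 + 1))
          + 1 / (2 * \<tau> 1) * B 1 - 1 / (2 * \<tau> 1) * B (1 + 1)
          + p (1 + 1) \<bullet> (v - y (1 + 1)) - \<tau> 1 * P (1 + 1)"
        using one_step[of 1] K \<beta>1 unfolding p1 left_diff_distrib by simp
      then have "\<gamma> 1 * (\<beta> 1 * Q (1 + 1)) \<le> \<gamma> 1 * (1 / (2 * \<eta> 1) * (A 1 - A (1 + 1))
          + 1 / (2 * \<tau> 1) * B 1 - 1 / (2 * \<tau> 1) * B (1 + 1)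
          + p (1 + 1) \<bullet> (v - y (1 + 1)) - \<tau> 1 * P (1 + 1))"
        using pos'(2)[of 1] by (intro mult_left_mono) auto
      then show ?case
        by (simp only: ring_distribs mult_ac)
    next
      case (step t)
      define s where "s = t + 1"
      have s: "s \<ge> 2" "s \<ge> 1" "s \<le> K" "s - 1 = t"
        using step by (auto simp: s_def)
      have t: "1 \<le> t" "t \<le> K"
        using step by auto
      have \<gamma>\<theta>: "\<gamma> s * \<theta> s = \<gamma> t"
        using \<theta>_eq[OF s(1)] pos'(2)[OF s(2)] s(4) by simp
      \<comment> \<open>The old gap term thus carries exactly the weight it has in the induction
        hypothesis.\<close>
      have \<gamma>\<beta>: "\<gamma> s * (\<beta> s - 1) = \<gamma> t * \<beta> t"
        using \<beta>_step[OF t(1)] \<gamma>\<theta> by (simp add: s_def mult.left_commute mult.commute)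
      have "\<gamma> s * (\<beta> s * Q (s + 1)) \<le> \<gamma> s * ((\<beta> s - 1) * Q s
          + 1 / (2 * \<eta> s) * (A s - A (s + 1))
          + (1 / (2 * \<tau> s) - \<mu>g / 2) * B s - 1 / (2 * \<tau> s) * B (s + 1)
          + p (s + 1) \<bullet> (v - y (s + 1)) - \<theta> s * (p s \<bullet> (v - y s))
          + \<theta> s * (p s \<bullet> (y (s + 1) - y s)) - \<tau> s * P (s + 1) - 1 / (4 * \<tau> s) * S s)"
        using one_step[OF s(2,3)] pos'(2)[OF s(2)] by (intro mult_left_mono) auto
      also have "\<dots> = (\<gamma> s * (\<beta> s - 1)) * Q s
          + \<gamma> s * (1 / (2 * \<eta> s)) * A s - \<gamma> s * (1 / (2 * \<eta> s)) * A (s + 1)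
          + \<gamma> s * (1 / (2 * \<tau> s) - \<mu>g / 2) * B s - \<gamma> s * (1 / (2 * \<tau> s)) * B (s + 1)
          + \<gamma> s * (p (s + 1) \<bullet> (v - y (s + 1))) - (\<gamma> s * \<theta> s) * (p s \<bullet> (v - y s))
          + (\<gamma> s * \<theta> s) * (p s \<bullet> (y (s + 1) - y s)) - \<gamma> s * \<tau> s * P (s + 1)
          - \<gamma> s * (1 / (4 * \<tau> s)) * S s"
        by (simp only: ring_distribs mult_ac)
      finally have main_ineq: "\<gamma> s * \<beta> s * Q (s + 1) \<le> \<gamma> t * \<beta> t * Q s
          + \<gamma> s * (1 / (2 * \<eta> s)) * A s - \<gamma> s * (1 / (2 * \<eta> s)) * A (s + 1)
          + \<gamma> s * (1 / (2 * \<tau> s) - \<mu>g / 2) * B s - \<gamma> s * (1 / (2 * \<tau> s)) * B (s + 1)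
          + \<gamma> s * (p (s + 1) \<bullet> (v - y (s + 1))) - \<gamma> t * (p s \<bullet> (v - y s))
          + \<gamma> t * (p s \<bullet> (y (s + 1) - y s)) - \<gamma> s * \<tau> s * P (s + 1)
          - \<gamma> s * (1 / (4 * \<tau> s)) * S s"
        unfolding \<gamma>\<theta> \<gamma>\<beta> by (simp only: mult.assoc)
      \<comment> \<open>Halving \<open>\<eta>_mono\<close> leaves a slack of \<open>Lxx / 4\<close>,
        and \<open>A s\<close> is at most twice the square of \<open>Dsc X\<close>.\<close>
      have "\<gamma> s * (1 / (2 * \<eta> s)) * A s \<le> (\<gamma> t * (1 / (2 * \<eta> t)) + Lxx / 4) * A s"
        using \<eta>_mono[OF s(1)] s(4) by (intro mult_right_mono) (auto simp: A_def)
      moreover have "Lxx / 4 * A s \<le> Lxx / 4 * (2 * (Dsc X)\<^sup>2)"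
        unfolding A_def using Lxx_nonneg X(2) u mem[of s] s
        by (intro mult_left_mono norm_sq_le_Dsc) (auto simp: compact_imp_bounded)
      ultimately have A_ineq: "\<gamma> s * (1 / (2 * \<eta> s)) * A s \<le>
          \<gamma> t * (1 / (2 * \<eta> t)) * A s + Lxx / 2 * (Dsc X)\<^sup>2"
        by (simp only: ring_distribs)
      have "\<gamma> s * (1 / (2 * \<tau> s) - \<mu>g / 2) \<le> \<gamma> t * (1 / (2 * \<tau> t))"
        using \<tau>_mono[OF s(1)] s(4) by (simp add: right_diff_distrib)
      then have B_ineq: "\<gamma> s * (1 / (2 * \<tau> s) - \<mu>g / 2) * B s \<le> \<gamma> t * (1 / (2 * \<tau> t)) * B s"
        by (rule mult_right_mono) (simp add: B_def)
      \<comment> \<open>This is the upper bound on \<open>\<theta> s\<close> multiplied by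
        \<open>\<gamma> s\<close>. It lets the \<open>S s\<close> term from Young's inequality,
        weighted with index \<open>t\<close>, be absorbed by the quarter kept back at index
        \<open>s\<close>.\<close>
      have "\<gamma> t / \<tau> t \<le> \<gamma> s / \<tau> s"
      proof -
        have "\<gamma> s * \<theta> s \<le> \<gamma> s * (\<tau> t / \<tau> s)"
          using \<theta>_bound[OF s(1)] s(4) pos'(2)[OF s(2)] by (intro mult_left_mono) auto
        then show ?thesis
          using pos'(3)[OF t(1)] unfolding \<gamma>\<theta> by (simp add: field_simps)
      qed
      then have S_ineq: "\<gamma> t * (1 / (4 * \<tau> t)) * S s \<le> \<gamma> s * (1 / (4 * \<tau> s)) * S s"
        by (intro mult_right_mono) (auto simp: S_def)
      \<comment> \<open>With \<open>r = \<tau> t\<close>, the \<open>P s\<close> part matches the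
        negative term of the induction hypothesis.\<close>
      have "\<gamma> t * (p s \<bullet> (y (s + 1) - y s)) \<le> \<gamma> t * (\<tau> t * P s + 1 / (4 * \<tau> t) * S s)"
        unfolding P_def S_def using Young_inner[OF pos'(3)[OF t(1)]] pos'(2)[OF t(1)]
        by (intro mult_left_mono) auto
      also have "\<dots> = \<gamma> t * \<tau> t * P s + \<gamma> t * (1 / (4 * \<tau> t)) * S s"
        by (simp only: ring_distribs mult.assoc)
      finally have "\<gamma> s * \<beta> s * Q (s + 1) \<le>
          \<gamma> 1 * (1 / (2 * \<eta> 1)) * A 1 + \<gamma> 1 * (1 / (2 * \<tau> 1)) * B 1
          + ((real t - 1) * (Lxx / 2 * (Dsc X)\<^sup>2) + Lxx / 2 * (Dsc X)\<^sup>2)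
          - \<gamma> s * (1 / (2 * \<eta> s)) * A (s + 1) - \<gamma> s * (1 / (2 * \<tau> s)) * B (s + 1)
          + \<gamma> s * (p (s + 1) \<bullet> (v - y (s + 1))) - \<gamma> s * \<tau> s * P (s + 1)"
        using main_ineq A_ineq B_ineq S_ineq step.IH[OF t(2)] unfolding s_def[symmetric]
        by linarith
      also have "(real t - 1) * (Lxx / 2 * (Dsc X)\<^sup>2) + Lxx / 2 * (Dsc X)\<^sup>2 =
          (real s - 1) * (Lxx / 2 * (Dsc X)\<^sup>2)"
        by (simp add: s_def field_simps)
      finally show ?case
        by (simp only: s_def Suc_eq_plus1)
    qed
    \<comment> \<open>No further iteration cancels the last inner product, so Young's inequality
      moves it onto \<open>P (K + 1)\<close> and \<open>B (K + 1)\<close>, both of which have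
      negative coefficients in \<open>potential\<close>.\<close>
    have "\<gamma> K * (p (K + 1) \<bullet> (v - y (K + 1))) \<le>
        \<gamma> K * (\<tau> K * P (K + 1) + 1 / (4 * \<tau> K) * B (K + 1))"
      unfolding P_def B_def using Young_inner[OF pos'(3)[OF K]] pos'(2)[OF K]
      by (intro mult_left_mono) auto
    also have "\<dots> \<le> \<gamma> K * (\<tau> K * P (K + 1) + 1 / (2 * \<tau> K) * B (K + 1))"
      using pos[OF K] by (intro mult_left_mono add_left_mono mult_right_mono) (auto simp: B_def field_simps)
    also have "\<dots> = \<gamma> K * \<tau> K * P (K + 1) + \<gamma> K * (1 / (2 * \<tau> K)) * B (K + 1)"
      by (simp only: ring_distribs mult.assoc)
    finally have "\<gamma> K * (p (K + 1) \<bullet> (v - y (K + 1))) \<le>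
        \<gamma> K * \<tau> K * P (K + 1) + \<gamma> K * (1 / (2 * \<tau> K)) * B (K + 1)" .
    moreover have "0 \<le> \<gamma> K * (1 / (2 * \<eta> K)) * A (K + 1)"
      using pos[OF K] by (auto simp: A_def)
    moreover have "\<gamma> 1 * (1 / (2 * \<eta> 1)) * A 1 \<le> \<gamma> 1 * (1 / (2 * \<eta> 1)) * (2 * (Dsc X)\<^sup>2)"
      unfolding A_def using pos[of 1] X(2) u init
      by (intro mult_left_mono norm_sq_le_Dsc) (auto simp: compact_imp_bounded)
    moreover have "\<gamma> 1 * (1 / (2 * \<tau> 1)) * B 1 \<le> \<gamma> 1 * (1 / (2 * \<tau> 1)) * (2 * (Dsc Y)\<^sup>2)"
      unfolding B_def using pos[of 1] Y(2) v init
      by (intro mult_left_mono norm_sq_le_Dsc) (auto simp: compact_imp_bounded)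
    \<comment> \<open>The accumulated slack is rounded up to the constant of the claim.\<close>
    moreover have "(real K - 1) * (Lxx / 2 * (Dsc X)\<^sup>2) \<le> real K * (Lxx * (Dsc X)\<^sup>2)"
      using Lxx_nonneg K by (intro mult_mono) auto
    moreover note potential[OF K order_refl]
    ultimately have "\<gamma> K * \<beta> K * Q (K + 1) \<le> \<gamma> 1 * (1 / (2 * \<eta> 1)) * (2 * (Dsc X)\<^sup>2)
        + \<gamma> 1 * (1 / (2 * \<tau> 1)) * (2 * (Dsc Y)\<^sup>2) + real K * (Lxx * (Dsc X)\<^sup>2)"
      by linarith
    then show ?thesis
      unfolding Q_def by (simp add: algebra_simps)
  qed

  \<comment> \<open>From comparison points to the supremum\<close>
  have c: "\<beta> K * \<gamma> K > 0"
    using pos[OF K] by simp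
  show ?thesis
    unfolding Gap_def
  proof (rule cSUP_least)
    show "X \<times> Y \<noteq> {}"
      using X(1) Y(1) by auto
    fix z
    assume "z \<in> X \<times> Y"
    then have "gapQ f \<phi> g (xb (K + 1), yb (K + 1)) z * (\<beta> K * \<gamma> K) \<le>
        (\<gamma> 1 / \<eta> 1 + real K * Lxx) * (Dsc X)\<^sup>2 + \<gamma> 1 / \<tau> 1 * (Dsc Y)\<^sup>2"
      using main[of "fst z" "snd z"] by (auto simp: mult.commute)
    then have "gapQ f \<phi> g (xb (K + 1), yb (K + 1)) z \<le>
        ((\<gamma> 1 / \<eta> 1 + real K * Lxx) * (Dsc X)\<^sup>2 + \<gamma> 1 / \<tau> 1 * (Dsc Y)\<^sup>2) / (\<beta> K * \<gamma> K)"
      using c by (simp only: pos_le_divide_eq)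
    also have "\<dots> = (\<gamma> 1 / (\<beta> K * \<gamma> K * \<eta> 1) + real K * Lxx / (\<beta> K * \<gamma> K)) * (Dsc X)\<^sup>2
        + \<gamma> 1 / (\<beta> K * \<gamma> K * \<tau> 1) * (Dsc Y)\<^sup>2"
      by (simp add: divide_inverse algebra_simps)
    finally show "gapQ f \<phi> g (xb (K + 1), yb (K + 1)) z \<le>
        (\<gamma> 1 / (\<beta> K * \<gamma> K * \<eta> 1) + real K * Lxx / (\<beta> K * \<gamma> K)) * (Dsc X)\<^sup>2
        + \<gamma> 1 / (\<beta> K * \<gamma> K * \<tau> 1) * (Dsc Y)\<^sup>2" .
  qed
qed

end
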